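(* Let $d\ge 2$ and $k\ge1$ be fixed and let $T$ be a tree with $k$ edges. For every sufficiently large natural number $n$, there exist a $k$-tuple $\vec w\in\mathbb R^k$ and a set $E$ of $n$ points in $\mathbb R^d$ such that the number of copies of $T_{\vec w}$ in $E$ is \[\gtrsim \max\left\{n^{1+\frac{k(d-1)}{d+1}},\ n^{\left\lceil\frac{k+1}{2}\right\rceil}\right\},\] with implied constant depending only on $k$ and $d$.
   Context: Write the vertices of $T$ as $v_1,\dots,v_{k+1}$ and list its $k$ edges in a fixed order $e_1,\dots,e_k$. For $\vec w=(\alpha_1,\dots,\alpha_k)$, $T_{\vec w}$ denotes $T$ with weight $\alpha_j$ on edge $e_j$. A copy of $T_{\vec w}$ in $E$ is an injective map $\varphi:\{v_1,\dots,v_{k+1}\}\to E$ such that whenever $e_j=\{v_a,v_b\}$ we have $\varphi(v_a)\cdot\varphi(v_b)=\alpha_j$ (standard dot product). The notation $X\gtrsim Y$ means $X\ge cY$ for some constant $c>0$. *)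

theory Defs
  imports "HOL-Analysis.Analysis"
begin

text \<open>
  A finite simple graph is given by its vertex set \<open>V\<close> and its set \<open>Es\<close> of edges, which are
  two-element subsets of \<open>V\<close>. The notion of tree in \<open>Graph_Theory.Digraph_Component\<close> is not
  suitable here: it excludes directed cycles only, so that an acyclically oriented triangle is a
  tree, while the symmetric digraph of a single edge is not.
\<close>

definition simple_graph :: "'v set \<Rightarrow> 'v set set \<Rightarrow> bool" where
  "simple_graph V Es \<longleftrightarrow> finite V \<and> (\<forall>e\<in>Es. \<exists>u\<in>V. \<exists>v\<in>V. u \<noteq> v \<and> e = {u, v})"

definition graph_walk :: "'v set \<Rightarrow> 'v set set \<Rightarrow> 'v list \<Rightarrow> bool" where
  "graph_walk V Es p \<longleftrightarrow> p \<noteq> [] \<and> set p \<subseteq> V \<and> successively (\<lambda>u v. {u, v} \<in> Es) p"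

definition graph_connected :: "'v set \<Rightarrow> 'v set set \<Rightarrow> bool" where
  "graph_connected V Es \<longleftrightarrow>
     V \<noteq> {} \<and> (\<forall>u\<in>V. \<forall>v\<in>V. \<exists>p. graph_walk V Es p \<and> hd p = u \<and> last p = v)"

text \<open>A cycle is represented by the list of its distinct vertices, without repeating the first.\<close>

definition graph_cycle :: "'v set \<Rightarrow> 'v set set \<Rightarrow> 'v list \<Rightarrow> bool" where
  "graph_cycle V Es p \<longleftrightarrow>
     graph_walk V Es p \<and> distinct p \<and> 3 \<le> length p \<and> {last p, hd p} \<in> Es"

definition graph_tree :: "'v set \<Rightarrow> 'v set set \<Rightarrow> bool" where
  "graph_tree V Es \<longleftrightarrow>
     simple_graph V Es \<and> graph_connected V Es \<and> \<not> (\<exists>p. graph_cycle V Es p)"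

text \<open>
  The edges are listed in \<open>es\<close>, and \<open>w ! j\<close> is the weight of the edge \<open>es ! j\<close>. Copies are
  taken as extensional functions on \<open>V\<close>, so that two of them are equal exactly when they agree
  on \<open>V\<close>, and their number is the cardinality of this set.
\<close>

definition weighted_copies ::
  "'v set \<Rightarrow> 'v set list \<Rightarrow> real list \<Rightarrow> 'a::real_inner set \<Rightarrow> ('v \<Rightarrow> 'a) set" where
  "weighted_copies V es w E =
     {\<phi> \<in> V \<rightarrow>\<^sub>E E. inj_on \<phi> V \<and>
        (\<forall>j<length es. \<forall>a b. es ! j = {a, b} \<longrightarrow> \<phi> a \<bullet> \<phi> b = w ! j)}"

end

theory Submission
  imports Defs
begin

text \<open>
  Each of the two terms of the maximum has its own construction. For the first, take lattice points
  \<open>(x, y)\<close> and hyperplanes \<open>y = a \<bullet> x + b\<close> with \<open>x, a\<close> in the box \<open>{-M..M}^(d - 1)\<close>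
  and \<open>y, b\<close> positive integers of size \<open>O(M^2)\<close>. Incidence means that \<open>(x, y)\<close> and
  \<open>(-a, 1) / b\<close> have dot product \<open>1\<close>. There are about \<open>n = M^(d + 1)\<close> objects of each kind, each
  incident to at least \<open>M^(d - 1)\<close> of the other kind. As trees are bipartite, embedding the vertices
  one at a time, with all weights \<open>1\<close>, gives at least about
  \<open>M^(d + 1) * (M^(d - 1))^k\<close> copies.

  For the second, the points \<open>(1, t)\<close> all have dot product \<open>s\<close> with \<open>(s, 0)\<close>. Fix the vertices of
  the smaller colour class at distinct points \<open>(s, 0)\<close>; the vertices of the larger class,
  at least \<open>(k + 1) / 2\<close> many, then range freely over the points \<open>(1, t)\<close>.
\<close>

section \<open>Trees grown leaf by leaf\<close>

text \<open>Rule induction on this predicate is induction over leaves. The colouring and both counts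
  rest on it, while \<open>graph_tree\<close> offers no such principle directly.\<close>

inductive grown_tree :: "'v set \<Rightarrow> 'v set set \<Rightarrow> bool" where
  single: "grown_tree {r} {}"
| leaf: "grown_tree V Es \<Longrightarrow> u \<in> V \<Longrightarrow> v \<notin> V \<Longrightarrow> grown_tree (insert v V) (insert {u, v} Es)"

lemma grown_tree_edge_subset: "grown_tree V Es \<Longrightarrow> e \<in> Es \<Longrightarrow> e \<subseteq> V"
  by (induction arbitrary: e rule: grown_tree.induct) auto

lemma grown_tree_finite: "grown_tree V Es \<Longrightarrow> finite V \<and> finite Es"
  by (induction rule: grown_tree.induct) auto

lemma grown_tree_card:
  assumes "grown_tree V Es"
  shows "card V = Suc (card Es)"
  using assms
proof (induction rule: grown_tree.induct)
  case (leaf V Es u v)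
  then have "{u, v} \<notin> Es"
    using grown_tree_edge_subset by blast
  then show ?case
    using leaf grown_tree_finite[OF leaf(1)] by simp
qed simp

text \<open>The new leaf lies on the new edge only, so giving it the colour opposite to its
  neighbour creates no conflict.\<close>

lemma grown_tree_coloring:
  assumes "grown_tree V Es"
  shows "\<exists>col :: 'v \<Rightarrow> bool. \<forall>a b. {a, b} \<in> Es \<longrightarrow> col a \<noteq> col b"
  using assms
proof (induction rule: grown_tree.induct)
  case (leaf V Es u v)
  then obtain col :: "'v \<Rightarrow> bool" where col: "\<And>a b. {a, b} \<in> Es \<Longrightarrow> col a \<noteq> col b"
    by blast
  have "v \<notin> e" if "e \<in> Es" for e
    using grown_tree_edge_subset[OF leaf(1) that] leaf(3) by blast
  then have "\<forall>a b. {a, b} \<in> insert {u, v} Es \<longrightarrow>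
      (col(v := \<not> col u)) a \<noteq> (col(v := \<not> col u)) b"
    using col leaf(2,3) by (auto simp: doubleton_eq_iff)
  then show ?case by blast
qed simp

lemma graph_walk_mono:
  "graph_walk V Es p \<Longrightarrow> V \<subseteq> V' \<Longrightarrow> Es \<subseteq> Es' \<Longrightarrow> graph_walk V' Es' p"
  unfolding graph_walk_def by (auto intro: successively_mono)

text \<open>A path to or from the new leaf is a path to or from its neighbour, extended by one
  vertex. Distinctness is kept because \<open>graph_cycle\<close> asks for it.\<close>

lemma grown_tree_path:
  assumes "grown_tree V Es" "a \<in> V" "b \<in> V"
  shows "\<exists>p. graph_walk V Es p \<and> distinct p \<and> hd p = a \<and> last p = b"
  using assms
proof (induction arbitrary: a b rule: grown_tree.induct)
  case (single r)
  then show ?case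
    by (intro exI[of _ "[r]"]) (auto simp: graph_walk_def)
next
  case (leaf V Es u v)
  let ?V = "insert v V" and ?Es = "insert {u, v} Es"
  consider "a = v" "b = v" | "a = v" "b \<in> V" | "a \<in> V" "b = v" | "a \<in> V" "b \<in> V"
    using leaf.prems by auto
  then show ?case
  proof cases
    case 1
    then show ?thesis
      by (intro exI[of _ "[v]"]) (auto simp: graph_walk_def)
  next
    case 2
    then obtain p where p: "graph_walk V Es p" "distinct p" "hd p = u" "last p = b"
      using leaf.IH leaf.hyps by blast
    have "graph_walk ?V ?Es p"
      by (rule graph_walk_mono[OF p(1)]) auto
    then have "graph_walk ?V ?Es (v # p)"
      using p(3) by (cases p) (auto simp: graph_walk_def insert_commute)
    then show ?thesis
      using p 2 leaf.hyps by (intro exI[of _ "v # p"]) (auto simp: graph_walk_def)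
  next
    case 3
    then obtain p where p: "graph_walk V Es p" "distinct p" "hd p = a" "last p = u"
      using leaf.IH leaf.hyps by blast
    have "graph_walk ?V ?Es p"
      by (rule graph_walk_mono[OF p(1)]) auto
    then have "graph_walk ?V ?Es (p @ [v])"
      using p(4) by (auto simp: graph_walk_def successively_append_iff)
    then show ?thesis
      using p 3 leaf.hyps by (intro exI[of _ "p @ [v]"]) (auto simp: graph_walk_def)
  next
    case 4
    then obtain p where p: "graph_walk V Es p" "distinct p" "hd p = a" "last p = b"
      using leaf.IH by blast
    have "graph_walk ?V ?Es p"
      by (rule graph_walk_mono[OF p(1)]) auto
    then show ?thesis
      using p by blast
  qed
qed

text \<open>Supplies the edge along which a non-spanning subtree can grow. The clause
  \<open>v \<in> set p\<close> puts the new vertex inside the ambient graph, where the walk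
  lives.\<close>

lemma walk_crossing_edge:
  assumes "successively (\<lambda>u v. {u, v} \<in> Es) p" "p \<noteq> []" "hd p \<in> W" "last p \<notin> W"
  shows "\<exists>u v. {u, v} \<in> Es \<and> u \<in> W \<and> v \<notin> W \<and> v \<in> set p"
  using assms
proof (induction p)
  case (Cons x p)
  show ?case
  proof (cases "p = []")
    case False
    then have "{x, hd p} \<in> Es" "successively (\<lambda>u v. {u, v} \<in> Es) p"
      using Cons.prems(1) by (auto simp: successively_Cons)
    then show ?thesis
      using Cons False hd_in_set[OF False] by (cases "hd p \<in> W") fastforce+
  qed (use Cons in auto)
qed simp

text \<open>
  A maximal grown subtree is spanning by connectedness; an edge outside it would close a cycle with
  the path joining its ends.
\<close>

lemma graph_tree_imp_grown_tree:
  assumes "graph_tree V Es"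
  shows "grown_tree V Es"
proof -
  have fin: "finite V" and edge: "\<And>e. e \<in> Es \<Longrightarrow> \<exists>u\<in>V. \<exists>v\<in>V. u \<noteq> v \<and> e = {u, v}"
    and ne: "V \<noteq> {}"
    and conn: "\<And>u v. u \<in> V \<Longrightarrow> v \<in> V \<Longrightarrow> \<exists>p. graph_walk V Es p \<and> hd p = u \<and> last p = v"
    and acyc: "\<And>p. \<not> graph_cycle V Es p"
    using assms unfolding graph_tree_def simple_graph_def graph_connected_def by blast+
  define sub where "sub = (\<lambda>(W, F). grown_tree W F \<and> W \<subseteq> V \<and> F \<subseteq> Es)"
  obtain r where "r \<in> V" using ne by blast
  then have "sub ({r}, {})"
    unfolding sub_def by (auto intro: grown_tree.single)
  moreover have "\<forall>S. sub S \<longrightarrow> card (fst S) < Suc (card V)"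
    unfolding sub_def using fin by (auto simp: less_Suc_eq_le intro: card_mono)
  ultimately have "\<exists>S. sub S \<and> (\<forall>S'. sub S' \<longrightarrow> card (fst S') \<le> card (fst S))"
    by (rule ex_has_greatest_nat)
  then obtain S where S: "sub S" "\<And>S'. sub S' \<Longrightarrow> card (fst S') \<le> card (fst S)"
    by blast
  obtain W F where WF: "S = (W, F)" by fastforce
  have W: "grown_tree W F" "W \<subseteq> V" "F \<subseteq> Es"
    using S(1) unfolding WF sub_def by auto
  have finW: "finite W" using W fin finite_subset by blast
  have "W = V"
  proof (rule ccontr)
    assume "W \<noteq> V"
    then obtain y where y: "y \<in> V" "y \<notin> W" using W by blast
    obtain x where x: "x \<in> W" using grown_tree_card[OF W(1)] by fastforce
    obtain p where p: "graph_walk V Es p" "hd p = x" "last p = y"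
      using conn x y W by blast
    then obtain u v where uv: "{u, v} \<in> Es" "u \<in> W" "v \<notin> W" "v \<in> set p"
      using walk_crossing_edge[of Es p W] x y unfolding graph_walk_def by blast
    have "sub (insert v W, insert {u, v} F)"
      unfolding sub_def using uv W p(1) by (auto simp: graph_walk_def intro: grown_tree.leaf)
    from S(2)[OF this] show False
      using uv finW by (simp add: WF)
  qed
  moreover have "F = Es"
  proof (rule ccontr)
    assume "F \<noteq> Es"
    then obtain e where e: "e \<in> Es" "e \<notin> F" using W by blast
    obtain a b where ab: "a \<in> V" "b \<in> V" "a \<noteq> b" "e = {a, b}"
      using edge[OF e(1)] by blast
    obtain p where p: "graph_walk W F p" "distinct p" "hd p = a" "last p = b"
      using grown_tree_path[OF W(1)] ab \<open>W = V\<close> by blast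
    \<comment> \<open>One vertex would force \<open>a = b\<close>. Two vertices would make
      \<open>e\<close> itself an edge of the path, hence of \<open>F\<close>.\<close>
    have "3 \<le> length p"
    proof (rule ccontr)
      assume "\<not> 3 \<le> length p"
      then have "length p = 0 \<or> length p = 1 \<or> length p = 2" by linarith
      then consider "p = []" | x where "p = [x]" | x y where "p = [x, y]"
        by (auto simp: length_Suc_conv numeral_2_eq_2)
      then show False
        using p ab e by cases (auto simp: graph_walk_def)
    qed
    then have "graph_cycle V Es p"
      using p e ab graph_walk_mono[OF p(1) W(2,3)]
      by (auto simp: graph_cycle_def insert_commute)
    then show False using acyc by blast
  qed
  ultimately show ?thesis using W by simp
qed

section \<open>Counting embeddings of a tree by minimum degree\<close>

text \<open>The first vertex has at least \<open>m\<close> images. Each new leaf has at least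
  \<open>D + k\<close> candidates, of which at most \<open>k\<close> are already occupied by earlier
  vertices, so the slack \<open>k\<close> pays for injectivity and \<open>D\<close> choices
  remain.\<close>

lemma card_embeddings_ge:
  fixes A :: "bool \<Rightarrow> 'a set" and R :: "'a \<Rightarrow> 'a \<Rightarrow> bool"
  assumes tree: "grown_tree V Es" "card Es \<le> k"
    and col: "\<And>a b. {a, b} \<in> Es \<Longrightarrow> col a \<noteq> col b"
    and sym: "\<And>x y. R x y \<Longrightarrow> R y x"
    and fin: "\<And>s. finite (A s)" and m: "\<And>s. m \<le> card (A s)"
    and deg: "\<And>s x. x \<in> A s \<Longrightarrow> D + k \<le> card {y \<in> A (\<not> s). R x y}"
  shows "m * D ^ card Es \<le>
    card {\<phi> \<in> (\<Pi>\<^sub>E v\<in>V. A (col v)). inj_on \<phi> V \<and> (\<forall>a b. {a, b} \<in> Es \<longrightarrow> R (\<phi> a) (\<phi> b))}"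
    (is "_ \<le> card (?H V Es)")
  using tree col
proof (induction rule: grown_tree.induct)
  case (single r)
  have "inj_on (\<lambda>x. \<lambda>v\<in>{r}. x) (A (col r))"
    by (rule inj_onI) (metis restrict_apply' singletonI)
  then have "card (A (col r)) = card ((\<lambda>x. \<lambda>v\<in>{r}. x) ` A (col r))"
    by (rule card_image[symmetric])
  also have "\<dots> \<le> card (?H {r} {})"
  proof (rule card_mono)
    show "finite (?H {r} {})"
      by (rule finite_subset[OF _ finite_PiE[of "{r}" "\<lambda>v. A (col v)"]]) (use fin in auto)
    show "(\<lambda>x. \<lambda>v\<in>{r}. x) ` A (col r) \<subseteq> ?H {r} {}"
      by (auto split: if_splits)
  qed
  finally have "card (A (col r)) \<le> card (?H {r} {})" .
  then show ?case using m[of "col r"] by simp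
next
  case (leaf V Es u v)
  note finV = grown_tree_finite[OF leaf.hyps(1)]
  have sub: "e \<subseteq> V" if "e \<in> Es" for e
    using grown_tree_edge_subset[OF leaf.hyps(1) that] .
  have new: "{u, v} \<notin> Es" using sub leaf.hyps by blast
  then have card_Es: "card (insert {u, v} Es) = Suc (card Es)"
    using finV by simp
  have colv: "col v = (\<not> col u)"
    using leaf.prems(2)[of u v] by auto
  have finH: "finite (?H W F)" if "finite W" for W F
    by (rule finite_subset[OF _ finite_PiE[of W "\<lambda>v. A (col v)"]]) (use fin that in auto)
  let ?N = "\<lambda>\<phi>. {y \<in> A (col v). R (\<phi> u) y} - \<phi> ` V"
  let ?ext = "\<lambda>(\<phi>, y). \<phi>(v := y)"
  have IH: "m * D ^ card Es \<le> card (?H V Es)"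
    using leaf.IH leaf.prems card_Es by auto
  have N: "D \<le> card (?N \<phi>)" if "\<phi> \<in> ?H V Es" for \<phi>
  proof -
    have "\<phi> u \<in> A (col u)" using that leaf.hyps by auto
    then have "D + k \<le> card {y \<in> A (col v). R (\<phi> u) y}"
      using deg colv by simp
    \<comment> \<open>The old tree has \<open>card Es + 1\<close> vertices, and this is the number
      of edges of the enlarged tree.\<close>
    moreover have "card (\<phi> ` V) \<le> k"
      using card_image_le[of V \<phi>] finV grown_tree_card[OF leaf.hyps(1)] leaf.prems(1) card_Es
      by linarith
    ultimately show ?thesis
      using diff_card_le_card_Diff[of "\<phi> ` V" "{y \<in> A (col v). R (\<phi> u) y}"] finV by simp
  qed
  have "m * D ^ card (insert {u, v} Es) \<le> card (?H V Es) * D"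
    using mult_right_mono[OF IH, of D] card_Es by (simp add: algebra_simps)
  also have "\<dots> \<le> (\<Sum>\<phi>\<in>?H V Es. card (?N \<phi>))"
    using sum_mono[of "?H V Es" "\<lambda>_. D" "\<lambda>\<phi>. card (?N \<phi>)"] N by simp
  also have "\<dots> = card (Sigma (?H V Es) ?N)"
    using finH finV fin by (subst card_SigmaI) auto
  also have "\<dots> = card (?ext ` Sigma (?H V Es) ?N)"
  proof (rule card_image[symmetric], rule inj_onI, clarsimp, intro conjI)
    fix \<phi> y \<psi> z
    assume ext: "\<phi> \<in> (\<Pi>\<^sub>E v\<in>V. A (col v))" "\<psi> \<in> (\<Pi>\<^sub>E v\<in>V. A (col v))"
      and eq: "\<phi>(v := y) = \<psi>(v := z)"
    show "y = z" using fun_cong[OF eq, of v] by simp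
    \<comment> \<open>Both maps are extensional on \<open>V\<close> and \<open>v\<close> lies
      outside, so the value overwritten at \<open>v\<close> was \<open>undefined\<close> for both
      and no information is lost.\<close>
    have "\<phi> v = \<psi> v" using ext leaf.hyps(3) by (metis PiE_E)
    then show "\<phi> = \<psi>" using eq by (metis fun_upd_triv fun_upd_upd)
  qed
  also have "\<dots> \<le> card (?H (insert v V) (insert {u, v} Es))"
  proof (rule card_mono)
    show "finite (?H (insert v V) (insert {u, v} Es))"
      by (rule finH) (use finV in simp)
    show "?ext ` Sigma (?H V Es) ?N \<subseteq> ?H (insert v V) (insert {u, v} Es)"
    proof
      fix \<psi>
      assume "\<psi> \<in> ?ext ` Sigma (?H V Es) ?N"
      then obtain \<phi> y where \<psi>: "\<psi> = \<phi>(v := y)"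
        and \<phi>: "\<phi> \<in> (\<Pi>\<^sub>E v\<in>V. A (col v))" "inj_on \<phi> V"
          "\<forall>a b. {a, b} \<in> Es \<longrightarrow> R (\<phi> a) (\<phi> b)"
        and y: "y \<in> A (col v)" "R (\<phi> u) y" "y \<notin> \<phi> ` V"
        by auto
      have "\<phi>(v := y) \<in> (\<Pi>\<^sub>E v\<in>insert v V. A (col v))"
        using \<phi>(1) y(1) by (rule PiE_fun_upd[rotated])
      moreover have "inj_on (\<phi>(v := y)) (insert v V)"
        using \<phi>(2) y(3) leaf.hyps(3) by (auto simp: inj_on_def)
      moreover have "R ((\<phi>(v := y)) a) ((\<phi>(v := y)) b)" if "{a, b} \<in> insert {u, v} Es" for a b
      proof (cases "{a, b} \<in> Es")
        case True
        then have "a \<noteq> v" "b \<noteq> v" using sub leaf.hyps(3) by blast+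
        then show ?thesis using \<phi>(3) True by simp
      next
        case False
        then have "a = u \<and> b = v \<or> a = v \<and> b = u"
          using that by (simp add: doubleton_eq_iff)
        moreover have "u \<noteq> v" using leaf.hyps by blast
        ultimately show ?thesis using y(2) sym by auto
      qed
      ultimately show "\<psi> \<in> ?H (insert v V) (insert {u, v} Es)"
        unfolding \<psi> by blast
    qed
  qed
  finally show ?case .
qed

section \<open>Padding a point set to exactly n points\<close>

lemma infinite_real_vec: "infinite (UNIV :: (real ^ 'd) set)"
proof -
  have "inj (\<lambda>t::real. vec t :: real ^ 'd)"
    by (rule injI) (simp add: vec_eq_iff)
  then show ?thesis
    using finite_imageD[of "\<lambda>t::real. vec t :: real ^ 'd" UNIV] infinite_UNIV_char_0[where 'a=real]
    by (metis finite_subset subset_UNIV)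
qed

text \<open>Copies survive when points are added, so a construction with at most \<open>n\<close>
  points suffices.\<close>

lemma weighted_copies_superset:
  fixes F :: "(real ^ 'd) set"
  assumes "finite V" "finite F" "card F \<le> n"
  shows "\<exists>E :: (real ^ 'd) set. finite E \<and> card E = n \<and>
    card (weighted_copies V es w F) \<le> card (weighted_copies V es w E)"
proof -
  have "infinite (UNIV - F)"
    using assms(2) infinite_real_vec by (simp add: Diff_infinite_finite)
  then obtain G where G: "finite G" "card G = n - card F" "G \<subseteq> UNIV - F"
    using infinite_arbitrarily_large by blast
  have "card (F \<union> G) = n"
    using G assms by (subst card_Un_disjoint) auto
  moreover have "weighted_copies V es w F \<subseteq> weighted_copies V es w (F \<union> G)"
    unfolding weighted_copies_def by (auto simp: PiE_iff)
  moreover have "finite (weighted_copies V es w (F \<union> G))"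
    unfolding weighted_copies_def
    by (rule finite_subset[OF _ finite_PiE[of V "\<lambda>_. F \<union> G"]]) (use G assms in auto)
  ultimately show ?thesis
    using G assms by (intro exI[of _ "F \<union> G"]) (auto intro: card_mono)
qed

section \<open>The construction on a line\<close>

text \<open>One of the two colour classes contains at least half of the vertices; \<open>S\<close>
  is chosen as the other one.\<close>

lemma grown_tree_big_class:
  assumes "grown_tree V Es"
  obtains S where "S \<subseteq> V" "\<And>a b. {a, b} \<in> Es \<Longrightarrow> a \<in> S \<longleftrightarrow> b \<notin> S"
    "card V \<le> 2 * card (V - S)"
proof -
  obtain col :: "'a \<Rightarrow> bool" where col: "\<And>a b. {a, b} \<in> Es \<Longrightarrow> col a \<noteq> col b"
    using grown_tree_coloring[OF assms] by blast
  have edge: "a \<in> V \<and> b \<in> V" if "{a, b} \<in> Es" for a b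
    using grown_tree_edge_subset[OF assms that] by blast
  let ?S = "{v \<in> V. col v}" and ?T = "{v \<in> V. \<not> col v}"
  have diff: "V - ?S = ?T" "V - ?T = ?S" by auto
  have "card (?S \<union> ?T) = card ?S + card ?T"
    using grown_tree_finite[OF assms] by (intro card_Un_disjoint) auto
  moreover have "?S \<union> ?T = V" by auto
  ultimately have "card V = card ?S + card ?T"
    by simp
  then have "card V \<le> 2 * card ?T \<or> card V \<le> 2 * card ?S"
    by arith
  then show ?thesis
  proof
    assume "card V \<le> 2 * card ?T"
    then show ?thesis
      by (intro that[of ?S]) (use diff col edge in auto)
  next
    assume "card V \<le> 2 * card ?S"
    then show ?thesis
      by (intro that[of ?T]) (use diff col edge in auto)
  qed
qed

lemma many_copies_collinear:
  fixes V :: "nat set"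
  assumes d: "CARD('d::finite) \<ge> 2" and tree: "grown_tree V (set es)"
    and len: "distinct es" "length es = k" and n: "4 * (k + 1) \<le> n"
  shows "\<exists>w (F :: (real ^ 'd) set). length w = k \<and> finite F \<and> card F \<le> n \<and>
    (1 / (2 * (real k + 1))) ^ (k + 1) * real n ^ nat \<lceil>(real k + 1) / 2\<rceil>
      \<le> real (card (weighted_copies V es w F))"
proof -
  have finV: "finite V" and cardV: "card V = k + 1"
    using grown_tree_finite[OF tree] grown_tree_card[OF tree] len
    by (auto simp: distinct_card)
  obtain S where S: "S \<subseteq> V" "\<And>a b. {a, b} \<in> set es \<Longrightarrow> a \<in> S \<longleftrightarrow> b \<notin> S"
    "card V \<le> 2 * card (V - S)"
    using grown_tree_big_class[OF tree] by blast
  obtain i j :: 'd where ij: "i \<noteq> j"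
    using d by (metis (full_types) card_le_Suc0_iff_eq finite not_less_eq_eq numeral_2_eq_2)
  \<comment> \<open>A coordinate plane inside the space; two different axes exist because the
    dimension is at least 2.\<close>
  define pt :: "real \<Rightarrow> real \<Rightarrow> real ^ 'd" where
    "pt x y = x *\<^sub>R axis i 1 + y *\<^sub>R axis j 1" for x y
  have inner_pt: "pt x y \<bullet> pt x' y' = x * x' + y * y'" for x y x' y'
    using ij by (simp add: pt_def inner_add_left inner_add_right inner_axis_axis)
  have pt_eq: "x = x' \<and> y = y'" if "pt x y = pt x' y'" for x y x' y'
    using inner_pt[of x y 1 0] inner_pt[of x' y' 1 0] inner_pt[of x y 0 1] inner_pt[of x' y' 0 1]
      that by simp
  \<comment> \<open>No vertex receives more than \<open>n div (k + 1)\<close> points, so the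
    \<open>k + 1\<close> vertices together use at most \<open>n\<close>.\<close>
  define m where "m = n div (k + 1) - 1"
  \<comment> \<open>The pairing \<open>prod_encode\<close> separates the candidates of different
    free vertices. The \<open>+ 1\<close> in the second coordinate keeps them off the axis that
    carries the fixed points; otherwise \<open>pt 1 0\<close> could occur twice.\<close>
  define F where "F v = (if v \<in> S then {pt (real v + 1) 0}
    else (\<lambda>t. pt 1 (real (prod_encode (v, t)) + 1)) ` {..<m})" for v
  \<comment> \<open>Each edge has exactly one end in \<open>S\<close>, so the sum has a single term:
    the first coordinate of the point of that end.\<close>
  define w where "w = map (\<lambda>e. \<Sum>u\<in>e \<inter> S. real u + 1) es"
  have finF: "finite (F v)" for v
    unfolding F_def by simp
  have cardF: "card (F v) = (if v \<in> S then 1 else m)" for v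
  proof -
    have "inj_on (\<lambda>t. pt 1 (real (prod_encode (v, t)) + 1)) {..<m}"
      by (rule inj_onI) (auto dest!: pt_eq)
    then show ?thesis unfolding F_def by (simp add: card_image)
  qed
  \<comment> \<open>The candidate sets are pairwise disjoint, so every choice function is
    automatically injective.\<close>
  have disj: "u = v" if "x \<in> F u" "x \<in> F v" for x u v
    using that unfolding F_def by (auto split: if_splits dest!: pt_eq)
  have weight: "x \<bullet> y = (\<Sum>u\<in>{a, b} \<inter> S. real u + 1)"
    if "{a, b} \<in> set es" "x \<in> F a" "y \<in> F b" for a b x y
  proof (cases "a \<in> S")
    case True
    then have "b \<notin> S" "{a, b} \<inter> S = {a}" using S(2)[OF that(1)] by auto
    then show ?thesis using that True by (auto simp: F_def inner_pt)
  next
    case False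
    then have "b \<in> S" "{a, b} \<inter> S = {b}" using S(2)[OF that(1)] by auto
    then show ?thesis using that False by (auto simp: F_def inner_pt)
  qed
  let ?F = "\<Union>v\<in>V. F v"
  have "PiE V F \<subseteq> weighted_copies V es w ?F"
  proof
    fix \<phi> assume \<phi>: "\<phi> \<in> PiE V F"
    have "inj_on \<phi> V"
      using \<phi> disj by (intro inj_onI) (metis PiE_mem)
    moreover have "\<phi> \<in> V \<rightarrow>\<^sub>E ?F"
      using \<phi> by (auto simp: PiE_iff)
    moreover have "\<phi> a \<bullet> \<phi> b = w ! l" if "l < length es" "es ! l = {a, b}" for l a b
    proof -
      have e: "{a, b} \<in> set es" using that by (metis nth_mem)
      then have "a \<in> V" "b \<in> V" using grown_tree_edge_subset[OF tree] by auto
      then show ?thesis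
        using weight[OF e, of "\<phi> a" "\<phi> b"] \<phi> that by (auto simp: w_def PiE_iff)
    qed
    ultimately show "\<phi> \<in> weighted_copies V es w ?F"
      unfolding weighted_copies_def by blast
  qed
  moreover have "finite (weighted_copies V es w ?F)"
    unfolding weighted_copies_def
    by (rule finite_subset[OF _ finite_PiE[of V "\<lambda>_. ?F"]]) (use finV finF in auto)
  ultimately have "card (PiE V F) \<le> card (weighted_copies V es w ?F)"
    by (intro card_mono)
  moreover have "card (PiE V F) = m ^ card (V - S)"
  proof -
    have "card (PiE V F) = (\<Prod>v\<in>V. if v \<in> S then 1 else m)"
      using finV by (simp add: card_PiE cardF)
    also have "\<dots> = (\<Prod>v\<in>V - S. m)"
      using finV by (intro prod.mono_neutral_cong_right) auto
    finally show ?thesis by simp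
  qed
  ultimately have copies: "m ^ card (V - S) \<le> card (weighted_copies V es w ?F)"
    by simp
  have q: "n div (k + 1) \<ge> 4"
    using n by (metis div_le_mono nonzero_mult_div_cancel_right add_is_0 one_neq_zero)
  have "card ?F \<le> (\<Sum>v\<in>V. card (F v))"
    using finV by (rule card_UN_le)
  also have "\<dots> \<le> (\<Sum>v\<in>V. n div (k + 1))"
    using q by (intro sum_mono) (auto simp: cardF m_def)
  also have "\<dots> \<le> n"
    using cardV div_times_less_eq_dividend[of n "k + 1"] by (simp add: mult.commute)
  finally have card_le: "card ?F \<le> n" .
  have "n < (n div (k + 1) + 1) * (k + 1)"
    by (metis Suc_eq_plus1 dividend_less_div_times mult_Suc mult.commute zero_less_Suc)
  then have "n < (m + 2) * (k + 1)"
    using q unfolding m_def by simp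
  \<comment> \<open>By assumption \<open>2 * (k + 1)\<close> is at most half of \<open>n\<close>, so
    \<open>m * (k + 1)\<close> accounts for the other half.\<close>
  then have "n \<le> 2 * (k + 1) * m"
    using n by (simp add: algebra_simps)
  then have "real n \<le> 2 * (real k + 1) * real m"
    by (metis (mono_tags) of_nat_le_iff of_nat_mult of_nat_numeral of_nat_add of_nat_1)
  then have m: "1 / (2 * (real k + 1)) * real n \<le> real m"
    by (simp add: field_simps)
  let ?c = "1 / (2 * (real k + 1))"
  have "nat \<lceil>(real k + 1) / 2\<rceil> \<le> card (V - S)"
    using S(3) cardV by (simp add: ceiling_le_iff)
  moreover have "card (V - S) \<le> k + 1"
    using cardV finV by (metis card_mono Diff_subset)
  \<comment> \<open>The base \<open>?c\<close> is at most 1 and its exponent drops; the base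
    \<open>n\<close> is at least 1 and its exponent rises.\<close>
  ultimately have "?c ^ (k + 1) * real n ^ nat \<lceil>(real k + 1) / 2\<rceil>
      \<le> ?c ^ card (V - S) * real n ^ card (V - S)"
    using n by (intro mult_mono power_decreasing power_increasing) auto
  also have "\<dots> = (?c * real n) ^ card (V - S)"
    by (rule power_mult_distrib[symmetric])
  also have "\<dots> \<le> real m ^ card (V - S)"
    using m by (intro power_mono) auto
  also have "\<dots> \<le> real (card (weighted_copies V es w ?F))"
    using copies by (metis of_nat_le_iff of_nat_power)
  finally have "?c ^ (k + 1) * real n ^ nat \<lceil>(real k + 1) / 2\<rceil>
    \<le> real (card (weighted_copies V es w ?F))" .
  then show ?thesis
    using card_le finV finF len by (intro exI[of _ w] exI[of _ ?F]) (auto simp: w_def)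
qed

section \<open>Lattice points and hyperplanes with many incidences\<close>

text \<open>Indexing by a set allows dimension \<open>CARD('d) - 1\<close> within the index type of
  \<open>real ^ 'd\<close>. Elements are extensional, so that agreement on \<open>I\<close> is
  equality.\<close>

definition int_box :: "'i set \<Rightarrow> int \<Rightarrow> ('i \<Rightarrow> int) set" where
  "int_box I M = (\<Pi>\<^sub>E i\<in>I. {-M..M})"

definition int_dot :: "'i set \<Rightarrow> ('i \<Rightarrow> int) \<Rightarrow> ('i \<Rightarrow> int) \<Rightarrow> int" where
  "int_dot I x a = (\<Sum>i\<in>I. x i * a i)"

lemma int_dot_commute: "int_dot I x a = int_dot I a x"
  by (simp add: int_dot_def mult.commute)

lemma finite_int_box: "finite I \<Longrightarrow> finite (int_box I M)"
  by (auto simp: int_box_def intro: finite_PiE)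

lemma card_int_box: "finite I \<Longrightarrow> card (int_box I (int M)) = (2 * M + 1) ^ card I"
  by (simp add: int_box_def card_PiE nat_add_distrib nat_mult_distrib)

lemma abs_int_dot_le:
  assumes "x \<in> int_box I M" "a \<in> int_box I M"
  shows "\<bar>int_dot I x a\<bar> \<le> int (card I) * M\<^sup>2"
proof -
  have "\<bar>int_dot I x a\<bar> \<le> (\<Sum>i\<in>I. \<bar>x i * a i\<bar>)"
    unfolding int_dot_def by (rule sum_abs)
  also have "\<dots> \<le> (\<Sum>i\<in>I. M\<^sup>2)"
  proof (rule sum_mono)
    fix i assume "i \<in> I"
    then have "\<bar>x i\<bar> \<le> M" "\<bar>a i\<bar> \<le> M"
      using assms by (auto simp: int_box_def PiE_iff abs_le_iff)
    then show "\<bar>x i * a i\<bar> \<le> M\<^sup>2"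
      unfolding abs_mult power2_eq_square by (intro mult_mono) auto
  qed
  finally show ?thesis by simp
qed

text \<open>Negation maps the box to itself and reverses the sign of the product, so the nonnegative
  part and its mirror image cover the box.\<close>

lemma half_int_box:
  assumes "finite I"
  shows "card (int_box I M) \<le> 2 * card {a \<in> int_box I M. 0 \<le> int_dot I x a}"
proof -
  let ?Z = "{a \<in> int_box I M. 0 \<le> int_dot I x a}"
  let ?neg = "\<lambda>a. \<lambda>i\<in>I. - a i"
  have finZ: "finite ?Z" using finite_int_box[OF assms] by simp
  have "int_box I M \<subseteq> ?Z \<union> ?neg ` ?Z"
  proof
    fix a assume a: "a \<in> int_box I M"
    show "a \<in> ?Z \<union> ?neg ` ?Z"
    proof (cases "0 \<le> int_dot I x a")
      case False
      have "int_dot I x (?neg a) = - int_dot I x a"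
        by (simp add: int_dot_def sum_negf)
      moreover have "?neg a \<in> int_box I M"
        using a by (auto simp: int_box_def PiE_iff)
      moreover have "a = ?neg (?neg a)"
        using a by (auto simp: int_box_def PiE_iff extensional_def)
      ultimately show ?thesis
        using False by (intro UnI2 image_eqI[of a ?neg "?neg a"]) auto
    qed (use a in simp)
  qed
  then have "card (int_box I M) \<le> card (?Z \<union> ?neg ` ?Z)"
    using finZ by (intro card_mono) auto
  also have "\<dots> \<le> card ?Z + card (?neg ` ?Z)"
    by (rule card_Un_le)
  also have "\<dots> \<le> 2 * card ?Z"
    using card_image_le[OF finZ, of ?neg] by simp
  finally show ?thesis .
qed

text \<open>
  A move of length at most \<open>K\<close> from \<open>t\<close> towards the centre of \<open>{1..2 * K + 1}\<close> stays in the
  interval, and by the symmetry of the box at least half of all shifts point towards the centre.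
\<close>

lemma half_int_box_shift:
  assumes "finite I" "x \<in> int_box I M" "int (card I) * M\<^sup>2 \<le> K" "t \<in> {1..2 * K + 1}" "\<bar>\<sigma>\<bar> = 1"
  shows "card (int_box I M) \<le>
    2 * card {a \<in> int_box I M. t + \<sigma> * int_dot I x a \<in> {1..2 * K + 1}}"
proof -
  have scale: "int_dot I (\<lambda>i. c * x i) a = c * int_dot I x a" for c a
    by (simp add: int_dot_def sum_distrib_left mult.assoc)
  \<comment> \<open>The sign for which \<open>0 \<le> c * int_dot I x a\<close> means a move towards
    the centre \<open>K + 1\<close>.\<close>
  define c where "c = (if t \<le> K + 1 then \<sigma> else - \<sigma>)"
  have "{a \<in> int_box I M. 0 \<le> int_dot I (\<lambda>i. c * x i) a}
      \<subseteq> {a \<in> int_box I M. t + \<sigma> * int_dot I x a \<in> {1..2 * K + 1}}"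
  proof clarify
    fix a assume a: "a \<in> int_box I M" and nonneg: "0 \<le> int_dot I (\<lambda>i. c * x i) a"
    have "\<bar>\<sigma> * int_dot I x a\<bar> \<le> K"
      using abs_int_dot_le[OF assms(2) a] assms(3,5) by (simp add: abs_mult)
    then show "t + \<sigma> * int_dot I x a \<in> {1..2 * K + 1}"
      using nonneg assms(4) unfolding scale c_def by (auto split: if_splits)
  qed
  then have "card {a \<in> int_box I M. 0 \<le> int_dot I (\<lambda>i. c * x i) a}
      \<le> card {a \<in> int_box I M. t + \<sigma> * int_dot I x a \<in> {1..2 * K + 1}}"
    using finite_int_box[OF assms(1)] by (intro card_mono) auto
  then show ?thesis
    using half_int_box[OF assms(1), of M "\<lambda>i. c * x i"] by linarith
qed

text \<open>\<open>A False\<close> holds the points and \<open>A True\<close> the vectors dual to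
  the hyperplanes. A point and a slope determine the intercept, and a hyperplane and an
  \<open>x\<close> determine the height; for at least half of the box the determined value is
  admissible.\<close>

lemma lattice_incidences:
  fixes M :: nat
  assumes d: "CARD('d::finite) \<ge> 2" and M: "M \<ge> 1"
  shows "\<exists>A :: bool \<Rightarrow> (real ^ 'd) set.
    (\<forall>s. finite (A s) \<and> M ^ (CARD('d) + 1) \<le> card (A s) \<and>
       card (A s) \<le> 3 ^ CARD('d) * CARD('d) * M ^ (CARD('d) + 1)) \<and>
    (\<forall>s. \<forall>x\<in>A s. M ^ (CARD('d) - 1) \<le> card {y \<in> A (\<not> s). x \<bullet> y = 1})"
proof -
  \<comment> \<open>An arbitrary coordinate serves as the height; the remaining ones form
    \<open>I\<close>.\<close>
  define i0 :: 'd where "i0 = undefined"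
  define I where "I = - {i0}"
  define d where "d = CARD('d)"
  have cardI: "card I = d - 1"
    unfolding I_def d_def by (simp add: Compl_eq_Diff_UNIV)
  have d2: "d \<ge> 2" using assms(1) unfolding d_def .
  have finI: "finite I" by simp
  define K where "K = int d * (int M)\<^sup>2"
  define B where "B = int_box I (int M)"
  \<comment> \<open>Common range of heights and intercepts. It starts at 1 so that dividing by an
    intercept is legitimate.\<close>
  define T where "T = {1..2 * K + 1}"
  have finB: "finite B" unfolding B_def by (rule finite_int_box[OF finI])
  have cardB: "card B = (2 * M + 1) ^ (d - 1)"
    unfolding B_def using card_int_box[OF finI] cardI by simp
  have K: "int (card I) * (int M)\<^sup>2 \<le> K"
    unfolding K_def cardI by (intro mult_right_mono) auto
  have cardT: "card T = 2 * d * M\<^sup>2 + 1"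
  proof -
    have "int (card T) = int (2 * d * M\<^sup>2 + 1)"
      unfolding T_def K_def by simp
    then show ?thesis by linarith
  qed
  define P where
    "P = (\<lambda>(x, y). (\<chi> i. if i = i0 then real_of_int y else real_of_int (x i)) :: real ^ 'd)"
  define Q where
    "Q = (\<lambda>(a, b). (\<chi> i. (if i = i0 then 1 else - real_of_int (a i)) / real_of_int b) :: real ^ 'd)"
  have inner_PQ: "P (x, y) \<bullet> Q (a, b) = real_of_int (y - int_dot I x a) / real_of_int b" for x y a b
  proof -
    have "P (x, y) \<bullet> Q (a, b) = (\<Sum>i\<in>insert i0 I. P (x, y) $ i * Q (a, b) $ i)"
      unfolding inner_vec_def I_def by (intro sum.cong) auto
    also have "\<dots> = P (x, y) $ i0 * Q (a, b) $ i0 + (\<Sum>i\<in>I. P (x, y) $ i * Q (a, b) $ i)"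
      by (rule sum.insert) (auto simp: I_def)
    also have "(\<Sum>i\<in>I. P (x, y) $ i * Q (a, b) $ i)
        = (\<Sum>i\<in>I. - (real_of_int (x i) * real_of_int (a i) / real_of_int b))"
      by (intro sum.cong) (auto simp: P_def Q_def I_def)
    finally show ?thesis
      by (simp add: P_def Q_def int_dot_def sum_negf diff_divide_distrib flip: sum_divide_distrib)
  qed
  have ext: "x = x'" if "x \<in> B" "x' \<in> B" "\<And>i. i \<in> I \<Longrightarrow> x i = x' i" for x x'
    using that unfolding B_def int_box_def by (rule PiE_ext)
  have injP: "inj_on P (B \<times> T)"
  proof (rule inj_onI, clarify)
    fix x y x' y'
    assume B: "x \<in> B" "x' \<in> B" and eq: "P (x, y) = P (x', y')"
    have comp: "P (x, y) $ i = P (x', y') $ i" for i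
      using eq by simp
    have "y = y'" using comp[of i0] by (simp add: P_def)
    moreover have "x i = x' i" if "i \<in> I" for i
      using comp[of i] that by (simp add: P_def I_def)
    ultimately show "x = x' \<and> y = y'" using ext B by blast
  qed
  have injQ: "inj_on Q (B \<times> T)"
  proof (rule inj_onI, clarify)
    fix a b a' b'
    assume B: "a \<in> B" "a' \<in> B" and T: "b \<in> T" "b' \<in> T" and eq: "Q (a, b) = Q (a', b')"
    have comp: "Q (a, b) $ i = Q (a', b') $ i" for i
      using eq by simp
    \<comment> \<open>Coordinate \<open>i0\<close> of the dual vector is \<open>1 / b\<close>; once
      \<open>b\<close> is known, the other coordinates give \<open>a\<close>.\<close>
    have "b = b'" using comp[of i0] by (simp add: Q_def)
    moreover have "a i = a' i" if "i \<in> I" for i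
      using comp[of i] that T \<open>b = b'\<close> by (simp add: Q_def I_def T_def)
    ultimately show "a = a' \<and> b = b'" using ext B by blast
  qed
  define A where "A = (\<lambda>s. (if s then Q else P) ` (B \<times> T))"
  have finA: "finite (A s)" for s
    using finB by (simp add: A_def T_def)
  have cardA: "card (A s) = (2 * M + 1) ^ (d - 1) * (2 * d * M\<^sup>2 + 1)" for s
    using injP injQ by (simp add: A_def card_image card_cartesian_product cardB cardT)
  have pow: "M ^ (d + 1) = M ^ (d - 1) * M\<^sup>2"
    using d2 by (simp flip: power_add)
  have lower: "M ^ (d + 1) \<le> card (A s)" for s
  proof -
    have "M\<^sup>2 \<le> d * M\<^sup>2" using d2 by simp
    then have "M\<^sup>2 \<le> 2 * d * M\<^sup>2 + 1" by linarith
    then show ?thesis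
      unfolding pow cardA by (intro mult_mono power_mono) auto
  qed
  have upper: "card (A s) \<le> 3 ^ d * d * M ^ (d + 1)" for s
  proof -
    have "1 * 1 \<le> d * M\<^sup>2" using d2 M by (intro mult_mono) auto
    then have "card (A s) \<le> (3 * M) ^ (d - 1) * (3 * d * M\<^sup>2)"
      unfolding cardA using M by (intro mult_mono power_mono) auto
    also have "\<dots> = (3 * 3 ^ (d - 1)) * d * (M ^ (d - 1) * M\<^sup>2)"
      by (simp add: algebra_simps)
    also have "3 * 3 ^ (d - 1) = (3 :: nat) ^ d"
      using d2 by (simp flip: power_Suc)
    finally show ?thesis using pow by simp
  qed
  \<comment> \<open>As \<open>d - 1\<close> is at least 1, the side length \<open>2 * M + 1\<close>
    gains a factor 2 over \<open>M ^ (d - 1)\<close>, which absorbs the loss of half of the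
    box.\<close>
  have half: "M ^ (d - 1) \<le> c" if "card B \<le> 2 * c" for c
  proof -
    have "2 * M ^ (d - 1) \<le> 2 ^ (d - 1) * M ^ (d - 1)"
      using d2 power_increasing[of 1 "d - 1" "2::nat"] by (intro mult_right_mono) auto
    also have "\<dots> = (2 * M) ^ (d - 1)"
      by (rule power_mult_distrib[symmetric])
    also have "\<dots> \<le> (2 * M + 1) ^ (d - 1)"
      by (intro power_mono) auto
    finally show ?thesis using that cardB by simp
  qed
  have degP: "M ^ (d - 1) \<le> card {q \<in> A True. p \<bullet> q = 1}" if p: "p \<in> A False" for p
  proof -
    obtain x y where xy: "x \<in> B" "y \<in> T" "p = P (x, y)"
      using p unfolding A_def by auto
    \<comment> \<open>Slopes whose hyperplane through the point has an admissible intercept; the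
      shift bound is applied with sign \<open>-1\<close>.\<close>
    let ?N = "{a \<in> B. y + (-1) * int_dot I x a \<in> T}"
    let ?f = "\<lambda>a. Q (a, y + (-1) * int_dot I x a)"
    have large: "card B \<le> 2 * card ?N"
      unfolding B_def T_def by (rule half_int_box_shift) (use xy K finI in \<open>auto simp: B_def T_def\<close>)
    have "inj_on ?f ?N"
    proof (rule inj_onI)
      fix a a' assume "a \<in> ?N" "a' \<in> ?N" "?f a = ?f a'"
      then show "a = a'" using inj_onD[OF injQ] by blast
    qed
    then have "card ?N = card (?f ` ?N)"
      by (rule card_image[symmetric])
    also have "\<dots> \<le> card {q \<in> A True. p \<bullet> q = 1}"
      by (rule card_mono[OF rev_finite_subset[OF finA[of True]]])
        (auto simp: A_def xy(3) inner_PQ T_def)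
    finally have "card ?N \<le> card {q \<in> A True. p \<bullet> q = 1}" .
    then show ?thesis using large by (intro half) linarith
  qed
  have degQ: "M ^ (d - 1) \<le> card {p \<in> A False. q \<bullet> p = 1}" if q: "q \<in> A True" for q
  proof -
    obtain a b where ab: "a \<in> B" "b \<in> T" "q = Q (a, b)"
      using q unfolding A_def by auto
    \<comment> \<open>The dual count: the slope is fixed, the position varies, and the sign is
      \<open>1\<close>.\<close>
    let ?N = "{x \<in> B. b + 1 * int_dot I a x \<in> T}"
    let ?f = "\<lambda>x. P (x, b + 1 * int_dot I a x)"
    have large: "card B \<le> 2 * card ?N"
      unfolding B_def T_def by (rule half_int_box_shift) (use ab K finI in \<open>auto simp: B_def T_def\<close>)
    have "inj_on ?f ?N"
    proof (rule inj_onI)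
      fix x x' assume "x \<in> ?N" "x' \<in> ?N" "?f x = ?f x'"
      then show "x = x'" using inj_onD[OF injP] by blast
    qed
    then have "card ?N = card (?f ` ?N)"
      by (rule card_image[symmetric])
    also have "\<dots> \<le> card {p \<in> A False. q \<bullet> p = 1}"
      by (rule card_mono[OF rev_finite_subset[OF finA[of False]]])
        (use ab(2) in \<open>auto simp: A_def ab(3) inner_PQ inner_commute[of "Q _"] int_dot_commute[of I a] T_def\<close>)
    finally have "card ?N \<le> card {p \<in> A False. q \<bullet> p = 1}" .
    then show ?thesis using large by (intro half) linarith
  qed
  have "M ^ (d - 1) \<le> card {y \<in> A (\<not> s). x \<bullet> y = 1}" if "x \<in> A s" for s x
    using degP degQ that by (cases s) auto
  then show ?thesis
    using finA lower upper unfolding d_def by blast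
qed

section \<open>Tree copies from the incidence configuration\<close>

text \<open>With \<open>M\<close> of order \<open>n ^ (1 / (d + 1))\<close>, the embedding count is
  of order \<open>M ^ (d + 1) * (M ^ (d - 1)) ^ k\<close>, the required power of \<open>n\<close>.
  Constant and threshold are chosen before the tree.\<close>

lemma many_copies_incidence:
  assumes d: "CARD('d::finite) \<ge> 2"
  shows "\<exists>c>0. \<exists>N. \<forall>(V :: nat set) es. grown_tree V (set es) \<and> distinct es \<and> length es = k \<longrightarrow>
    (\<forall>n\<ge>N. \<exists>w (F :: (real ^ 'd) set). length w = k \<and> finite F \<and> card F \<le> n \<and>
      c * real n powr (1 + real k * (real CARD('d) - 1) / (real CARD('d) + 1))
        \<le> real (card (weighted_copies V es w F)))"
proof -
  define d where "d = CARD('d)"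
  have d2: "d \<ge> 2" using assms unfolding d_def .
  define e where "e = 1 + real k * (real d - 1) / (real d + 1)"
  \<comment> \<open>Twice the size factor of one class, since the point set is the union of both
    classes.\<close>
  define C where "C = 2 * 3 ^ d * d"
  have C: "C > 0" using d2 unfolding C_def by simp
  \<comment> \<open>Halves of \<open>r\<close> account for rounding \<open>r\<close> down to
    \<open>M\<close>, the further \<open>/ 2\<close> for subtracting \<open>k\<close> from the
    degree, and \<open>C powr e\<close> for passing from \<open>r\<close> to
    \<open>n\<close>.\<close>
  define c where "c = (1 / 2) ^ (d + 1) * ((1 / 2) ^ (d - 1) / 2) ^ k / real C powr e"
  have "c > 0" using C unfolding c_def by simp
  moreover have "\<exists>w (F :: (real ^ 'd) set). length w = k \<and> finite F \<and> card F \<le> n \<and>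
      c * real n powr e \<le> real (card (weighted_copies V es w F))"
    if tree: "grown_tree V (set es)" "distinct es" "length es = k"
      and n: "n \<ge> C * (2 * k + 1) ^ (d + 1)" for V :: "nat set" and es n
  proof -
    have cardEs: "card (set es) = k" using tree by (simp add: distinct_card)
    define r where "r = root (d + 1) (real n / real C)"
    have r0: "0 \<le> r" unfolding r_def by simp
    have r_pow: "r ^ (d + 1) = real n / real C"
      unfolding r_def by (rule real_root_pow_pos2) auto
    have n_r: "real n = real C * r ^ (d + 1)"
      using r_pow C by simp
    \<comment> \<open>The threshold on \<open>n\<close> makes \<open>M\<close> at least
      \<open>2 * k + 1\<close>, so at least half of the degree \<open>M ^ (d - 1)\<close> remains
      after removing \<open>k\<close>.\<close>
    have "real (2 * k + 1) ^ (d + 1) \<le> r ^ (d + 1)"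
    proof -
      have "real C * real (2 * k + 1) ^ (d + 1) \<le> real n"
        using n by (metis of_nat_le_iff of_nat_mult of_nat_power)
      then show ?thesis unfolding n_r using C by simp
    qed
    then have r: "real (2 * k + 1) \<le> r"
      using r0 power_le_imp_le_base[of "real (2 * k + 1)" d r] by simp
    define M where "M = nat \<lfloor>r\<rfloor>"
    have M_le: "real M \<le> r" and M_gt: "r < real M + 1"
      unfolding M_def using r0 by linarith+
    have M_ge: "2 * k + 1 \<le> M"
      using r unfolding M_def by (simp add: le_nat_floor)
    have M_half: "r / 2 \<le> real M"
      using M_gt M_ge by linarith
    have "real (C * M ^ (d + 1)) \<le> real C * r ^ (d + 1)"
      using M_le by (simp add: mult_left_mono power_mono del: power_Suc)
    then have CM: "C * M ^ (d + 1) \<le> n"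
      unfolding n_r[symmetric] by linarith
    obtain A :: "bool \<Rightarrow> (real ^ 'd) set" where A: "\<And>s. finite (A s)"
      "\<And>s. M ^ (d + 1) \<le> card (A s)" "\<And>s. card (A s) \<le> 3 ^ d * d * M ^ (d + 1)"
      "\<And>s x. x \<in> A s \<Longrightarrow> M ^ (d - 1) \<le> card {y \<in> A (\<not> s). x \<bullet> y = 1}"
      using lattice_incidences[OF d, of M] M_ge unfolding d_def by auto
    obtain col :: "nat \<Rightarrow> bool" where col: "\<And>a b. {a, b} \<in> set es \<Longrightarrow> col a \<noteq> col b"
      using grown_tree_coloring[OF tree(1)] by blast
    let ?F = "A False \<union> A True"
    define w where "w = replicate k (1 :: real)"
    have AF: "A s \<subseteq> ?F" for s by (cases s) auto
    have "card ?F \<le> card (A False) + card (A True)"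
      by (rule card_Un_le)
    also have "\<dots> \<le> C * M ^ (d + 1)"
      using A(3)[of True] A(3)[of False] unfolding C_def by simp
    finally have card_le: "card ?F \<le> n" using CM by simp
    have "M ^ 1 \<le> M ^ (d - 1)"
      using d2 M_ge by (intro power_increasing) auto
    then have MD: "2 * k \<le> M ^ (d - 1)" using M_ge by simp
    let ?H = "{\<phi> \<in> (\<Pi>\<^sub>E v\<in>V. A (col v)). inj_on \<phi> V \<and>
      (\<forall>a b. {a, b} \<in> set es \<longrightarrow> \<phi> a \<bullet> \<phi> b = 1)}"
    have "M ^ (d + 1) * (M ^ (d - 1) - k) ^ card (set es) \<le> card ?H"
    proof (rule card_embeddings_ge[OF tree(1), where k = k and R = "\<lambda>x y. x \<bullet> y = 1"])
      show "M ^ (d - 1) - k + k \<le> card {y \<in> A (\<not> s). x \<bullet> y = 1}" if "x \<in> A s" for s x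
        using A(4)[OF that] MD by simp
    qed (use A cardEs col in \<open>auto simp: inner_commute\<close>)
    also have "card ?H \<le> card (weighted_copies V es w ?F)"
    proof (rule card_mono)
      have "finite V" using grown_tree_finite[OF tree(1)] by simp
      then show "finite (weighted_copies V es w ?F)"
        unfolding weighted_copies_def
        by (intro rev_finite_subset[OF finite_PiE[of V "\<lambda>_. ?F"]]) (use A in auto)
      show "?H \<subseteq> weighted_copies V es w ?F"
      proof
        fix \<phi> assume \<phi>: "\<phi> \<in> ?H"
        then have "\<phi> \<in> V \<rightarrow>\<^sub>E ?F" using AF by (auto simp: PiE_iff)
        moreover have "\<phi> a \<bullet> \<phi> b = w ! j" if "j < length es" "es ! j = {a, b}" for j a b
        proof -
          have "{a, b} \<in> set es" using that by (metis nth_mem)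
          then show ?thesis using \<phi> that tree(3) by (simp add: w_def)
        qed
        ultimately show "\<phi> \<in> weighted_copies V es w ?F"
          using \<phi> unfolding weighted_copies_def by blast
      qed
    qed
    finally have "M ^ (d + 1) * (M ^ (d - 1) - k) ^ k \<le> card (weighted_copies V es w ?F)"
      using cardEs by simp
    then have copies: "real M ^ (d + 1) * real (M ^ (d - 1) - k) ^ k
        \<le> real (card (weighted_copies V es w ?F))"
      by (metis of_nat_le_iff of_nat_mult of_nat_power)
    have "(r / 2) ^ (d - 1) \<le> real M ^ (d - 1)"
      using M_half r0 by (intro power_mono) auto
    moreover have "real (M ^ (d - 1)) / 2 \<le> real (M ^ (d - 1) - k)"
      using MD by linarith
    ultimately have deg: "(r / 2) ^ (d - 1) / 2 \<le> real (M ^ (d - 1) - k)"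
      by simp
    have r_pos: "r > 0" using r by simp
    \<comment> \<open>Since \<open>n\<close> is \<open>C * r ^ (d + 1)\<close>, the real exponent
      \<open>e\<close> turns into a natural exponent of \<open>r\<close>.\<close>
    have exponent: "real (d + 1) * e = real (d + 1 + (d - 1) * k)"
      using d2 unfolding e_def by (simp add: field_simps)
    have "real n powr e = real C powr e * (r ^ (d + 1)) powr e"
      unfolding n_r by (rule powr_mult)
    also have "(r ^ (d + 1)) powr e = r powr (real (d + 1) * e)"
      by (simp only: powr_realpow[OF r_pos, symmetric] powr_powr)
    also have "\<dots> = r ^ (d + 1) * (r ^ (d - 1)) ^ k"
      unfolding exponent using r_pos
      by (simp only: powr_realpow power_add power_mult)
    finally have "c * real n powr e
        = (1 / 2) ^ (d + 1) * ((1 / 2) ^ (d - 1) / 2) ^ k * (r ^ (d + 1) * (r ^ (d - 1)) ^ k)"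
      using C unfolding c_def by simp
    also have "\<dots> = (r / 2) ^ (d + 1) * ((r / 2) ^ (d - 1) / 2) ^ k"
      by (simp add: power_divide power_mult_distrib)
    also have "\<dots> \<le> real M ^ (d + 1) * real (M ^ (d - 1) - k) ^ k"
      using M_half deg r0 by (intro mult_mono power_mono) auto
    finally have "c * real n powr e \<le> real (card (weighted_copies V es w ?F))"
      using copies by linarith
    then show ?thesis
      using card_le A(1) by (intro exI[of _ w] exI[of _ ?F]) (auto simp: w_def)
  qed
  ultimately show ?thesis
    unfolding e_def d_def C_def by blast
qed

section \<open>Combining the two constructions\<close>

theorem theorem1p3:
  fixes k :: nat
  assumes "CARD('d::finite) \<ge> 2" and "k \<ge> 1"
  shows "\<exists>c::real. c > 0 \<and>
    (\<forall>(V :: nat set) (es :: nat set list).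
       graph_tree V (set es) \<and> distinct es \<and> length es = k \<longrightarrow>
       (\<exists>N::nat. \<forall>n\<ge>N.
          \<exists>(w :: real list) (E :: (real ^ 'd) set).
            length w = k \<and> finite E \<and> card E = n \<and>
            real (card (weighted_copies V es w E)) \<ge>
              c * max (real n powr (1 + real k * (real CARD('d) - 1) / (real CARD('d) + 1)))
                      (real n ^ nat \<lceil>(real k + 1) / 2\<rceil>)))"
proof -
  let ?a = "\<lambda>n. real n powr (1 + real k * (real CARD('d) - 1) / (real CARD('d) + 1))"
  let ?b = "\<lambda>n. real n ^ nat \<lceil>(real k + 1) / 2\<rceil>"
  obtain c\<^sub>1 N where c1: "c\<^sub>1 > 0" and incidence:
    "\<And>(V :: nat set) es n. grown_tree V (set es) \<Longrightarrow> distinct es \<Longrightarrow> length es = k \<Longrightarrow> n \<ge> N \<Longrightarrow>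
      \<exists>w (F :: (real ^ 'd) set). length w = k \<and> finite F \<and> card F \<le> n \<and>
        c\<^sub>1 * ?a n \<le> real (card (weighted_copies V es w F))"
    using many_copies_incidence[OF assms(1), of k] by blast
  define c\<^sub>2 where "c\<^sub>2 = (1 / (2 * (real k + 1))) ^ (k + 1)"
  have c2: "c\<^sub>2 > 0" unfolding c\<^sub>2_def by simp
  have main: "\<exists>w (E :: (real ^ 'd) set). length w = k \<and> finite E \<and> card E = n \<and>
      real (card (weighted_copies V es w E)) \<ge> min c\<^sub>1 c\<^sub>2 * max (?a n) (?b n)"
    if tree: "graph_tree V (set es)" "distinct es" "length es = k"
      and n: "n \<ge> max N (4 * (k + 1))" for V :: "nat set" and es n
  proof -
    have grown: "grown_tree V (set es)"
      using tree(1) by (rule graph_tree_imp_grown_tree)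
    have "\<exists>w (F :: (real ^ 'd) set). length w = k \<and> finite F \<and> card F \<le> n \<and>
        min c\<^sub>1 c\<^sub>2 * max (?a n) (?b n) \<le> real (card (weighted_copies V es w F))"
    \<comment> \<open>The maximum equals one of its two terms, so for each \<open>n\<close> the
      construction belonging to the larger term is used.\<close>
    proof (cases "?b n \<le> ?a n")
      case True
      have "min c\<^sub>1 c\<^sub>2 * max (?a n) (?b n) \<le> c\<^sub>1 * ?a n"
        using True by (simp add: mult_right_mono)
      then show ?thesis
        using incidence[OF grown tree(2,3), of n] n order_trans by fastforce
    next
      case False
      have "min c\<^sub>1 c\<^sub>2 * max (?a n) (?b n) \<le> c\<^sub>2 * ?b n"
        using False by (simp add: max_def mult_right_mono)
      then show ?thesis
        using many_copies_collinear[OF assms(1) grown tree(2,3), of n] n order_trans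
        unfolding c\<^sub>2_def by fastforce
    qed
    then obtain w and F :: "(real ^ 'd) set" where F: "length w = k" "finite F" "card F \<le> n"
      "min c\<^sub>1 c\<^sub>2 * max (?a n) (?b n) \<le> real (card (weighted_copies V es w F))"
      by blast
    have "finite V" using grown_tree_finite[OF grown] by simp
    from weighted_copies_superset[OF this F(2,3), of es w]
    obtain E :: "(real ^ 'd) set" where "finite E" "card E = n"
      "card (weighted_copies V es w F) \<le> card (weighted_copies V es w E)"
      by blast
    then show ?thesis
      using F(1,4) by (intro exI[of _ w] exI[of _ E]) linarith
  qed
  show ?thesis
    by (intro exI[of _ "min c\<^sub>1 c\<^sub>2"] conjI allI impI exI[of _ "max N (4 * (k + 1))"])
      (use c1 c2 main in auto)
qed

end
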